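(* Let $A=\{a_0<a_1<a_2<a_3\}$ be a set of integers and $\mathbf{r}=(r_0,r_1,r_2,r_3)$ an ordered $4$-tuple of positive integers. Suppose $h$ is an integer with $2\le h\le r_0+r_1+r_2+r_3-2$. Then: (i) if $r_1=r_2=1$, then $|h^{(\mathbf{r})}A|=L(\mathbf{r},h)$ if and only if $a_1-a_0=a_3-a_2$; (ii) if $r_1\ge 2$ or $r_2\ge 2$, then $|h^{(\mathbf{r})}A|=L(\mathbf{r},h)$ if and only if $A$ is a $4$-term arithmetic progression.
   Context: Here $k=4$. Define $$h^{(\mathbf{r})}A=\Big\{\sum_{i=0}^{k-1}s_ia_i:\ s_i\in\mathbb{Z},\ 0\le s_i\le r_i,\ \sum_{i=0}^{k-1}s_i=h\Big\}.$$ Empty sums are $0$. Let $I_{\mathbf{r}}(h)$ be the largest integer (with $0\le I_{\mathbf{r}}(h)\le k$) such that $\sum_{j=0}^{I_{\mathbf{r}}(h)-1}r_j\le h$, and $M_{\mathbf{r}}(h)$ the least integer (with $-1\le M_{\mathbf{r}}(h)\le k-1$) such that $\sum_{j=M_{\mathbf{r}}(h)+1}^{k-1}r_j\le h$. Put $\delta_{\mathbf{r}}(h)=h-\sum_{j=0}^{I_{\mathbf{r}}(h)-1}r_j$, $\theta_{\mathbf{r}}(h)=h-\sum_{j=M_{\mathbf{r}}(h)+1}^{k-1}r_j$, and $$L(\mathbf{r},h)=\sum_{j=M_{\mathbf{r}}(h)+1}^{k-1}j r_j-\sum_{j=0}^{I_{\mathbf{r}}(h)-1}j r_j+M_{\mathbf{r}}(h)\,\theta_{\mathbf{r}}(h)-I_{\mathbf{r}}(h)\,\delta_{\mathbf{r}}(h)+1.$$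 *)

theory Defs
  imports Main
begin

text \<open>
  Throughout, the set \<open>A\<close> with elements \<open>a\<^sub>0 < \<dots> < a\<^sub>k\<^sub>-\<^sub>1\<close> and the tuple \<open>(r\<^sub>0, \<dots>, r\<^sub>k\<^sub>-\<^sub>1)\<close> are given by
  functions on \<^typ>\<open>nat\<close>, of which only the values at \<open>0, \<dots>, k - 1\<close> matter.
\<close>

definition restricted_sumset :: "nat \<Rightarrow> (nat \<Rightarrow> int) \<Rightarrow> int \<Rightarrow> (nat \<Rightarrow> int) \<Rightarrow> int set" where
  "restricted_sumset k r h a =
     {\<Sum>i<k. s i * a i | s. (\<forall>i<k. 0 \<le> s i \<and> s i \<le> r i) \<and> (\<Sum>i<k. s i) = h}"

definition I_idx :: "nat \<Rightarrow> (nat \<Rightarrow> int) \<Rightarrow> int \<Rightarrow> nat" where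
  "I_idx k r h = (GREATEST I. I \<le> k \<and> (\<Sum>j<I. r j) \<le> h)"

text \<open>
  \<open>M_idx\<close> may be \<open>-1\<close>, so it is an integer; since it is at least \<open>-1\<close>, the summation range
  \<open>{nat (M + 1)..<k}\<close> consists of the indices from \<open>M + 1\<close> to \<open>k - 1\<close>.
\<close>

definition M_idx :: "nat \<Rightarrow> (nat \<Rightarrow> int) \<Rightarrow> int \<Rightarrow> int" where
  "M_idx k r h =
     (LEAST M. - 1 \<le> M \<and> M \<le> int k - 1 \<and> (\<Sum>j\<in>{nat (M + 1)..<k}. r j) \<le> h)"

definition delta :: "nat \<Rightarrow> (nat \<Rightarrow> int) \<Rightarrow> int \<Rightarrow> int" where
  "delta k r h = h - (\<Sum>j<I_idx k r h. r j)"

definition theta :: "nat \<Rightarrow> (nat \<Rightarrow> int) \<Rightarrow> int \<Rightarrow> int" where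
  "theta k r h = h - (\<Sum>j\<in>{nat (M_idx k r h + 1)..<k}. r j)"

definition L_bound :: "nat \<Rightarrow> (nat \<Rightarrow> int) \<Rightarrow> int \<Rightarrow> int" where
  "L_bound k r h =
     (\<Sum>j\<in>{nat (M_idx k r h + 1)..<k}. int j * r j) - (\<Sum>j<I_idx k r h. int j * r j)
     + M_idx k r h * theta k r h - int (I_idx k r h) * delta k r h + 1"

definition is_arith_prog :: "nat \<Rightarrow> int set \<Rightarrow> bool" where
  "is_arith_prog k A \<longleftrightarrow> (\<exists>c d. d \<noteq> 0 \<and> A = {c + int i * d | i. i < k})"

end

theory Submission
  imports Defs
begin

text \<open>
  Call \<open>s\<^sub>1 + 2s\<^sub>2 + 3s\<^sub>3\<close> the index sum of an admissible tuple \<open>s\<close>. Moving one unit from position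
  \<open>i\<close> to \<open>i + 1\<close> raises the index sum by one and strictly raises the value \<open>\<Sum>s\<^sub>ia\<^sub>i\<close>, and such a
  move is possible unless the index sum is already maximal. Hence through every admissible tuple
  passes a strictly increasing chain of \<open>L\<close> values. If the sumset has exactly \<open>L\<close> elements, the
  rank of a value is therefore its index sum, so equal index sums force equal values; the
  converse is clear. A tuple that allows the moves \<open>i \<rightarrow> i + 1\<close> and \<open>j \<rightarrow> j + 1\<close> then gives
  \<open>a\<^sub>i\<^sub>+\<^sub>1 - a\<^sub>i = a\<^sub>j\<^sub>+\<^sub>1 - a\<^sub>j\<close>.
\<close>

section \<open>Restricted sums as quadruples\<close>

type_synonym int4 = "int \<times> int \<times> int \<times> int"

text \<open>Quadruples replace functions on \<open>nat\<close>, whose irrelevant values beyond index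
  3 would spoil finiteness.\<close>

definition admissible :: "(nat \<Rightarrow> int) \<Rightarrow> int \<Rightarrow> int4 set" where
  "admissible r h = {(x, y, z, w). 0 \<le> x \<and> x \<le> r 0 \<and> 0 \<le> y \<and> y \<le> r 1 \<and> 0 \<le> z \<and> z \<le> r 2 \<and>
     0 \<le> w \<and> w \<le> r 3 \<and> x + y + z + w = h}"

fun index_sum :: "int4 \<Rightarrow> int" where
  "index_sum (x, y, z, w) = y + 2 * z + 3 * w"

fun value_sum :: "(nat \<Rightarrow> int) \<Rightarrow> int4 \<Rightarrow> int" where
  "value_sum a (x, y, z, w) = x * a 0 + y * a 1 + z * a 2 + w * a 3"

text \<open>
  The least index sum counts, for \<open>j = 1, 2, 3\<close>, the units that do not fit into the positions
  below \<open>j\<close>; dually for the greatest one.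
\<close>

definition min_index :: "(nat \<Rightarrow> int) \<Rightarrow> int \<Rightarrow> int" where
  "min_index r h = max 0 (h - r 0) + max 0 (h - r 0 - r 1) + max 0 (h - r 0 - r 1 - r 2)"

definition max_index :: "(nat \<Rightarrow> int) \<Rightarrow> int \<Rightarrow> int" where
  "max_index r h =
     3 * h - max 0 (h - r 3) - max 0 (h - r 3 - r 2) - max 0 (h - r 3 - r 2 - r 1)"

lemma restricted_sumset_4: "restricted_sumset 4 r h a = value_sum a ` admissible r h"
proof (intro equalityI subsetI)
  fix v assume "v \<in> restricted_sumset 4 r h a"
  then obtain s where s: "\<forall>i<4. 0 \<le> s i \<and> s i \<le> r i" "(\<Sum>i<4. s i) = h" "v = (\<Sum>i<4. s i * a i)"
    unfolding restricted_sumset_def by blast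
  have "(s 0, s 1, s 2, s 3) \<in> admissible r h"
    using s(1,2) by (auto simp: admissible_def eval_nat_numeral)
  moreover have "v = value_sum a (s 0, s 1, s 2, s 3)"
    using s(3) by (simp add: eval_nat_numeral)
  ultimately show "v \<in> value_sum a ` admissible r h" by blast
next
  fix v assume "v \<in> value_sum a ` admissible r h"
  then obtain x y z w where s: "(x, y, z, w) \<in> admissible r h" "v = value_sum a (x, y, z, w)"
    by auto
  define s where "s = (\<lambda>i::nat. if i = 0 then x else if i = 1 then y else if i = 2 then z else w)"
  have "v = (\<Sum>i<4. s i * a i)" "(\<Sum>i<4. s i) = h" "\<forall>i<4. 0 \<le> s i \<and> s i \<le> r i"
    using s by (auto simp: s_def admissible_def eval_nat_numeral less_Suc_eq)
  then show "v \<in> restricted_sumset 4 r h a"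
    unfolding restricted_sumset_def by blast
qed

lemma finite_admissible: "finite (admissible r h)"
proof (rule finite_subset)
  show "admissible r h \<subseteq> {0..r 0} \<times> {0..r 1} \<times> {0..r 2} \<times> {0..r 3}"
    by (auto simp: admissible_def)
qed auto

lemma ex_sum_between:
  fixes l u l' u' n :: int
  assumes "l \<le> u" "l' \<le> u'" "l + l' \<le> n" "n \<le> u + u'"
  shows "\<exists>x y. l \<le> x \<and> x \<le> u \<and> l' \<le> y \<and> y \<le> u' \<and> x + y = n"
  \<comment> \<open>The first witness is the least \<open>x \<ge> l\<close> whose complement
    \<open>n - x\<close> respects the upper bound \<open>u'\<close>.\<close>
  using assms by (intro exI[of _ "max l (n - u')"] exI[of _ "n - max l (n - u')"]) auto

text \<open>Serves to find tuples with room for prescribed moves: a lower bound 1 lets a unit leave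
  a position, an upper bound \<open>r i - 1\<close> lets one enter.\<close>

lemma ex_sum4_between:
  fixes l0 u0 l1 u1 l2 u2 l3 u3 n :: int
  assumes "l0 \<le> u0" "l1 \<le> u1" "l2 \<le> u2" "l3 \<le> u3"
    and "l0 + l1 + l2 + l3 \<le> n" "n \<le> u0 + u1 + u2 + u3"
  obtains x y z w where "l0 \<le> x" "x \<le> u0" "l1 \<le> y" "y \<le> u1" "l2 \<le> z" "z \<le> u2" "l3 \<le> w" "w \<le> u3"
    "x + y + z + w = n"
proof -
  obtain p q where pq: "l0 + l1 \<le> p" "p \<le> u0 + u1" "l2 + l3 \<le> q" "q \<le> u2 + u3" "p + q = n"
    using ex_sum_between[of "l0 + l1" "u0 + u1" "l2 + l3" "u2 + u3" n] assms by auto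
  obtain x y where "l0 \<le> x" "x \<le> u0" "l1 \<le> y" "y \<le> u1" "x + y = p"
    using ex_sum_between[of l0 u0 l1 u1 p] assms pq by auto
  moreover obtain z w where "l2 \<le> z" "z \<le> u2" "l3 \<le> w" "w \<le> u3" "z + w = q"
    using ex_sum_between[of l2 u2 l3 u3 q] assms pq by auto
  ultimately show ?thesis using pq(5) that by auto
qed

section \<open>The bound as the length of the index range\<close>

text \<open>The terms with \<open>I_idx\<close> form the index sum of the tuple packed greedily from
  the left, those with \<open>M_idx\<close> that of the tuple packed from the right.\<close>

lemma L_bound_4:
  assumes r: "r 0 > 0" "r 1 > 0" "r 2 > 0" "r 3 > 0"
    and h: "0 \<le> h" "h < r 0 + r 1 + r 2 + r 3"
  shows "L_bound 4 r h = max_index r h - min_index r h + 1"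
proof -
  have below: "(\<Sum>j<I. int j * r j) + int I * (h - (\<Sum>j<I. r j)) = min_index r h"
    if "I = I_idx 4 r h" for I
  proof -
    have sums: "(\<Sum>j<2. f j) = f 0 + f 1" "(\<Sum>j<3. f j) = f 0 + f 1 + f 2"
      "(\<Sum>j<4. f j) = f 0 + f 1 + f 2 + f 3" for f :: "nat \<Rightarrow> int"
      by (simp_all add: eval_nat_numeral)
    have le4: "y = 0 \<or> y = 1 \<or> y = 2 \<or> y = 3 \<or> y = 4" if "y \<le> 4" for y :: nat
      using that by presburger
    \<comment> \<open>The value 4 is excluded because \<open>h\<close> is strictly below the sum of
      all \<open>r j\<close>.\<close>
    define J :: nat where "J = (if h < r 0 then 0 else if h < r 0 + r 1 then 1
      else if h < r 0 + r 1 + r 2 then 2 else 3)"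
    have "I_idx 4 r h = J"
      unfolding I_idx_def
    proof (rule Greatest_equality)
      show "J \<le> 4 \<and> (\<Sum>j<J. r j) \<le> h"
        using h by (auto simp: J_def sums)
      fix y assume y: "y \<le> 4 \<and> (\<Sum>j<y. r j) \<le> h"
      then show "y \<le> J"
        using le4[of y] r h by (auto simp: J_def sums)
    qed
    then show ?thesis
      using that r h by (auto simp: J_def sums min_index_def max_def algebra_simps)
  qed
  have above: "(\<Sum>j\<in>{nat (M + 1)..<4}. int j * r j) + M * (h - (\<Sum>j\<in>{nat (M + 1)..<4}. r j))
      = max_index r h" if "M = M_idx 4 r h" for M
  proof -
    have sums: "(\<Sum>j\<in>{0..<4}. f j) = f 0 + f 1 + f 2 + f 3" "(\<Sum>j\<in>{1..<4}. f j) = f 1 + f 2 + f 3"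
      "(\<Sum>j\<in>{2..<4}. f j) = f 2 + f 3" "(\<Sum>j\<in>{3..<4}. f j) = f 3" for f :: "nat \<Rightarrow> int"
      by (simp_all add: eval_nat_numeral)
    have le3: "y = -1 \<or> y = 0 \<or> y = 1 \<or> y = 2 \<or> y = 3" if "- 1 \<le> y" "y \<le> 3" for y :: int
      using that by presburger
    \<comment> \<open>For the same reason -1 is excluded; the value 3 belongs to the empty
      sum.\<close>
    define J :: int where "J = (if h < r 3 then 3 else if h < r 3 + r 2 then 2
      else if h < r 3 + r 2 + r 1 then 1 else 0)"
    have "M_idx 4 r h = J"
      unfolding M_idx_def
    proof (rule Least_equality)
      show "- 1 \<le> J \<and> J \<le> int 4 - 1 \<and> (\<Sum>j\<in>{nat (J + 1)..<4}. r j) \<le> h"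
        using h by (auto simp: J_def sums[simplified])
      fix y assume y: "- 1 \<le> y \<and> y \<le> int 4 - 1 \<and> (\<Sum>j\<in>{nat (y + 1)..<4}. r j) \<le> h"
      then show "J \<le> y"
        using le3[of y] r h by (auto simp: J_def sums[simplified])
    qed
    then show ?thesis
      using that r h by (auto simp: J_def sums[simplified] max_index_def max_def algebra_simps)
  qed
  show ?thesis
    using below[OF refl] above[OF refl] by (simp add: L_bound_def delta_def theta_def)
qed

section \<open>Chains of unit moves and the number of values\<close>

text \<open>If no unit can move down, then \<open>w > 0\<close> forces \<open>z = r 2\<close>,
  \<open>z > 0\<close> forces \<open>y = r 1\<close>, and \<open>y > 0\<close> forces
  \<open>x = r 0\<close>. As \<open>r 1\<close> and \<open>r 2\<close> are positive, these
  implications chain, so the tuple is packed from the left.\<close>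

lemma ex_move_down:
  assumes "a 0 < a 1" "a 1 < a 2" "a 2 < a 3" and r: "0 < r 1" "0 < r 2"
    and s: "s \<in> admissible r h" and "index_sum s \<noteq> min_index r h"
  obtains t where "t \<in> admissible r h" "index_sum t = index_sum s - 1" "value_sum a t < value_sum a s"
proof -
  obtain x y z w where xyzw: "s = (x, y, z, w)" by (cases s)
  have "(0 < y \<and> x < r 0) \<or> (0 < z \<and> y < r 1) \<or> (0 < w \<and> z < r 2)"
    using r s assms(7) by (auto simp: xyzw admissible_def min_index_def max_def split: if_splits)
  then consider "0 < y" "x < r 0" | "0 < z" "y < r 1" | "0 < w" "z < r 2" by blast
  then show ?thesis
  proof cases
    case 1
    then show ?thesis using s assms
      by (intro that[of "(x + 1, y - 1, z, w)"]) (auto simp: xyzw admissible_def algebra_simps)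
  next
    case 2
    then show ?thesis using s assms
      by (intro that[of "(x, y + 1, z - 1, w)"]) (auto simp: xyzw admissible_def algebra_simps)
  next
    case 3
    then show ?thesis using s assms
      by (intro that[of "(x, y, z + 1, w - 1)"]) (auto simp: xyzw admissible_def algebra_simps)
  qed
qed

lemma ex_move_up:
  assumes "a 0 < a 1" "a 1 < a 2" "a 2 < a 3" and r: "0 < r 1" "0 < r 2"
    and s: "s \<in> admissible r h" and "index_sum s \<noteq> max_index r h"
  obtains t where "t \<in> admissible r h" "index_sum t = index_sum s + 1" "value_sum a s < value_sum a t"
proof -
  obtain x y z w where xyzw: "s = (x, y, z, w)" by (cases s)
  have "(0 < x \<and> y < r 1) \<or> (0 < y \<and> z < r 2) \<or> (0 < z \<and> w < r 3)"
    using r s assms(7) by (auto simp: xyzw admissible_def max_index_def max_def split: if_splits)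
  then consider "0 < x" "y < r 1" | "0 < y" "z < r 2" | "0 < z" "w < r 3" by blast
  then show ?thesis
  proof cases
    case 1
    then show ?thesis using s assms
      by (intro that[of "(x - 1, y + 1, z, w)"]) (auto simp: xyzw admissible_def algebra_simps)
  next
    case 2
    then show ?thesis using s assms
      by (intro that[of "(x, y - 1, z + 1, w)"]) (auto simp: xyzw admissible_def algebra_simps)
  next
    case 3
    then show ?thesis using s assms
      by (intro that[of "(x, y, z - 1, w + 1)"]) (auto simp: xyzw admissible_def algebra_simps)
  qed
qed

lemma index_sum_bounds:
  assumes "s \<in> admissible r h"
  shows "min_index r h \<le> index_sum s" "index_sum s \<le> max_index r h"
  using assms by (auto simp: admissible_def min_index_def max_index_def)

text \<open>Each move down reaches a strictly smaller value; the final 1 counts the value at the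
  bottom of the chain.\<close>

lemma card_values_le:
  assumes a: "a 0 < a 1" "a 1 < a 2" "a 2 < a 3" and r: "0 < r 1" "0 < r 2"
    and "s \<in> admissible r h"
  shows "index_sum s - min_index r h + 1
    \<le> int (card {v \<in> value_sum a ` admissible r h. v \<le> value_sum a s})"
  using \<open>s \<in> admissible r h\<close>
proof (induction "nat (index_sum s - min_index r h)" arbitrary: s rule: less_induct)
  case less
  let ?below = "\<lambda>s. {v \<in> value_sum a ` admissible r h. v \<le> value_sum a s}"
  have fin: "finite (?below s)" for s using finite_admissible by simp
  show ?case
  proof (cases "index_sum s = min_index r h")
    case True
    have "?below s \<noteq> {}" using less.prems by auto
    then have "card (?below s) > 0" using fin by (simp add: card_gt_0_iff)
    then show ?thesis using True by simp
  next
    case False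
    then obtain t where t: "t \<in> admissible r h" "index_sum t = index_sum s - 1"
      "value_sum a t < value_sum a s"
      using ex_move_down[OF a r less.prems] by blast
    have "index_sum t - min_index r h + 1 \<le> int (card (?below t))"
      using less.hyps[of t] t index_sum_bounds(1)[OF less.prems] False by simp
    moreover have "?below t \<subset> ?below s" using t less.prems by force
    then have "card (?below t) < card (?below s)" using fin by (rule psubset_card_mono[rotated])
    ultimately show ?thesis using t(2) by simp
  qed
qed

text \<open>The value of \<open>s\<close> itself is left out here, so this bound and that of
  \<open>card_values_le\<close> add up to the same total for every \<open>s\<close>.\<close>

lemma card_values_gt:
  assumes a: "a 0 < a 1" "a 1 < a 2" "a 2 < a 3" and r: "0 < r 1" "0 < r 2"
    and "s \<in> admissible r h"
  shows "max_index r h - index_sum s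
    \<le> int (card {v \<in> value_sum a ` admissible r h. value_sum a s < v})"
  using \<open>s \<in> admissible r h\<close>
proof (induction "nat (max_index r h - index_sum s)" arbitrary: s rule: less_induct)
  case less
  let ?above = "\<lambda>s. {v \<in> value_sum a ` admissible r h. value_sum a s < v}"
  have fin: "finite (?above s)" for s using finite_admissible by simp
  show ?case
  proof (cases "index_sum s = max_index r h")
    case True
    then show ?thesis by simp
  next
    case False
    then obtain t where t: "t \<in> admissible r h" "index_sum t = index_sum s + 1"
      "value_sum a s < value_sum a t"
      using ex_move_up[OF a r less.prems] by blast
    have "max_index r h - index_sum t \<le> int (card (?above t))"
      using less.hyps[of t] t index_sum_bounds(2)[OF less.prems] False by simp
    moreover have "?above t \<subset> ?above s" using t by force
    then have "card (?above t) < card (?above s)" using fin by (rule psubset_card_mono[rotated])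
    ultimately show ?thesis using t(2) by simp
  qed
qed

lemma card_values_eq_iff:
  assumes a: "a 0 < a 1" "a 1 < a 2" "a 2 < a 3" and r: "0 < r 1" "0 < r 2"
    and nonempty: "admissible r h \<noteq> {}"
  shows "int (card (value_sum a ` admissible r h)) = max_index r h - min_index r h + 1 \<longleftrightarrow>
    (\<forall>s \<in> admissible r h. \<forall>t \<in> admissible r h.
       index_sum s = index_sum t \<longrightarrow> value_sum a s = value_sum a t)"
    (is "int (card ?V) = ?L \<longleftrightarrow> ?R")
proof -
  have fin: "finite ?V" using finite_admissible by simp
  have split: "card ?V = card {v \<in> ?V. v \<le> x} + card {v \<in> ?V. x < v}" for x
  proof -
    have "?V = {v \<in> ?V. v \<le> x} \<union> {v \<in> ?V. x < v}" by auto
    then show ?thesis using card_Un_disjoint[of "{v \<in> ?V. v \<le> x}" "{v \<in> ?V. x < v}"] fin by force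
  qed
  show ?thesis
  proof (intro iffI ballI impI)
    fix s t assume eq: "int (card ?V) = ?L" and st: "s \<in> admissible r h" "t \<in> admissible r h"
      and idx: "index_sum s = index_sum t"
    \<comment> \<open>The two lower bounds sum to \<open>?L\<close>, so a set of exactly that size
      leaves no slack in either.\<close>
    have rank: "int (card {v \<in> ?V. v \<le> value_sum a u}) = index_sum u - min_index r h + 1"
      if "u \<in> admissible r h" for u
      using split[of "value_sum a u"] card_values_le[OF a r that] card_values_gt[OF a r that] eq by linarith
    have "\<not> value_sum a t < value_sum a u"
      if "t \<in> admissible r h" "u \<in> admissible r h" "index_sum t = index_sum u" for t u
    proof
      assume "value_sum a t < value_sum a u"
      then have "{v \<in> ?V. v \<le> value_sum a t} \<subset> {v \<in> ?V. v \<le> value_sum a u}" using that by force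
      then have "card {v \<in> ?V. v \<le> value_sum a t} < card {v \<in> ?V. v \<le> value_sum a u}"
        using fin by (intro psubset_card_mono) auto
      then show False using rank[OF that(1)] rank[OF that(2)] that(3) by linarith
    qed
    from this[OF st idx] this[OF st(2,1) idx[symmetric]]
    show "value_sum a s = value_sum a t" by linarith
  next
    assume R: ?R
    obtain s where s: "s \<in> admissible r h" using nonempty by blast
    have "?L \<le> int (card ?V)"
      using split[of "value_sum a s"] card_values_le[OF a r s] card_values_gt[OF a r s] by linarith
    moreover have "int (card ?V) \<le> ?L"
    proof -
      \<comment> \<open>At indices that no tuple attains, \<open>f\<close> is arbitrary; this is
        harmless, since only an upper bound on the image is wanted.\<close>
      define f where "f n = value_sum a (SOME t. t \<in> admissible r h \<and> index_sum t = n)" for n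
      have "value_sum a u = f (index_sum u)" if "u \<in> admissible r h" for u
      proof -
        have "\<exists>t. t \<in> admissible r h \<and> index_sum t = index_sum u" using that by blast
        from someI_ex[OF this] show ?thesis using R that unfolding f_def by metis
      qed
      then have "?V \<subseteq> f ` {min_index r h..max_index r h}"
        using index_sum_bounds by fastforce
      then have "card ?V \<le> card {min_index r h..max_index r h}"
        by (rule surj_card_le[rotated]) simp
      also have "\<dots> = nat ?L" by simp
      finally show ?thesis
        using index_sum_bounds[OF s] by linarith
    qed
    ultimately show "int (card ?V) = ?L" by linarith
  qed
qed

section \<open>Four-term progressions\<close>

lemma is_arith_prog_4_iff:
  assumes "a 0 < a 1" "a 1 < a 2" "a 2 < (a 3 :: int)"
  shows "is_arith_prog 4 {a 0, a 1, a 2, a 3} \<longleftrightarrow> a 1 - a 0 = a 2 - a 1 \<and> a 2 - a 1 = a 3 - a 2"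
proof -
  have prog: "{c + int i * d | i. i < 4} = {c, c + d, c + 2 * d, c + 3 * d}" for c d
  proof -
    have "{c + int i * d | i. i < 4} = (\<lambda>i. c + int i * d) ` {..<4}" by auto
    also have "{..<4} = {0, 1, 2, 3 :: nat}" by auto
    finally show ?thesis by simp
  qed
  show ?thesis
  proof
    assume "is_arith_prog 4 {a 0, a 1, a 2, a 3}"
    then obtain c d where d: "d \<noteq> 0" and eq: "{a 0, a 1, a 2, a 3} = {c, c + d, c + 2 * d, c + 3 * d}"
      by (auto simp: is_arith_prog_def prog)
    \<comment> \<open>A negative difference lists the same set backwards, so the increasing list of
      \<open>a\<close> is matched with the reversed progression.\<close>
    consider "d > 0" | "d < 0" using d by linarith
    then show "a 1 - a 0 = a 2 - a 1 \<and> a 2 - a 1 = a 3 - a 2"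
    proof cases
      case 1
      have "[a 0, a 1, a 2, a 3] = [c, c + d, c + 2 * d, c + 3 * d]"
        by (rule sorted_distinct_set_unique) (use assms eq 1 in auto)
      then show ?thesis by auto
    next
      case 2
      have "[a 0, a 1, a 2, a 3] = [c + 3 * d, c + 2 * d, c + d, c]"
        by (rule sorted_distinct_set_unique) (use assms eq 2 in auto)
      then show ?thesis by auto
    qed
  next
    assume eq: "a 1 - a 0 = a 2 - a 1 \<and> a 2 - a 1 = a 3 - a 2"
    then have "a 1 = a 0 + (a 1 - a 0)" "a 2 = a 0 + 2 * (a 1 - a 0)" "a 3 = a 0 + 3 * (a 1 - a 0)"
      by auto
    then have "{a 0, a 1, a 2, a 3} = {a 0 + int i * (a 1 - a 0) | i. i < 4}"
      unfolding prog by metis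
    then show "is_arith_prog 4 {a 0, a 1, a 2, a 3}"
      unfolding is_arith_prog_def using assms(1) by (intro exI[of _ "a 0"] exI[of _ "a 1 - a 0"]) auto
  qed
qed

section \<open>From equal values to equal gaps\<close>

theorem theorem4:
  fixes A :: "int set" and a r :: "nat \<Rightarrow> int" and h :: int
  assumes "A = {a 0, a 1, a 2, a 3}"
    and "a 0 < a 1" and "a 1 < a 2" and "a 2 < a 3"
    and "\<forall>i<4. r i > 0"
    and "2 \<le> h" and "h \<le> r 0 + r 1 + r 2 + r 3 - 2"
  shows "(r 1 = 1 \<and> r 2 = 1 \<longrightarrow>
            (int (card (restricted_sumset 4 r h a)) = L_bound 4 r h \<longleftrightarrow> a 1 - a 0 = a 3 - a 2)) \<and>
         (r 1 \<ge> 2 \<or> r 2 \<ge> 2 \<longrightarrow>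
            (int (card (restricted_sumset 4 r h a)) = L_bound 4 r h \<longleftrightarrow> is_arith_prog 4 A))"
proof -
  note a = assms(2-4) and h = assms(6,7)
  have r: "r 0 > 0" "r 1 > 0" "r 2 > 0" "r 3 > 0" using assms(5) by auto
  let ?P = "admissible r h"
  define determined where "determined \<longleftrightarrow>
    (\<forall>s \<in> ?P. \<forall>t \<in> ?P. index_sum s = index_sum t \<longrightarrow> value_sum a s = value_sum a t)"
  have determinedD: "value_sum a s = value_sum a t"
    if determined "s \<in> ?P" "t \<in> ?P" "index_sum s = index_sum t" for s t
    using that unfolding determined_def by blast
  \<comment> \<open>One tuple must allow both moves 0 to 1 and 2 to 3. This asks for two occupied
    and two unfilled places, which is what the bounds on \<open>h\<close> provide.\<close>
  have outer: "a 1 - a 0 = a 3 - a 2" if determined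
  proof -
    obtain x y z w where s: "1 \<le> x" "x \<le> r 0" "0 \<le> y" "y \<le> r 1 - 1" "1 \<le> z" "z \<le> r 2"
      "0 \<le> w" "w \<le> r 3 - 1" "x + y + z + w = h"
      by (rule ex_sum4_between[of 1 "r 0" 0 "r 1 - 1" 1 "r 2" 0 "r 3 - 1" h]) (use r h in auto)
    have "value_sum a (x - 1, y + 1, z, w) = value_sum a (x, y, z - 1, w + 1)"
      by (rule determinedD[OF that]) (use s in \<open>auto simp: admissible_def\<close>)
    then show ?thesis by (simp add: algebra_simps)
  qed
  \<comment> \<open>Moves 0 to 1 and 1 to 2 from one tuple need position 1 neither empty nor full,
    hence \<open>r 1 \<ge> 2\<close>.\<close>
  have left: "a 1 - a 0 = a 2 - a 1" if determined and big: "r 1 \<ge> 2"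
  proof -
    obtain x y z w where s: "1 \<le> x" "x \<le> r 0" "1 \<le> y" "y \<le> r 1 - 1" "0 \<le> z" "z \<le> r 2 - 1"
      "0 \<le> w" "w \<le> r 3" "x + y + z + w = h"
      by (rule ex_sum4_between[of 1 "r 0" 1 "r 1 - 1" 0 "r 2 - 1" 0 "r 3" h]) (use r h big in auto)
    have "value_sum a (x - 1, y + 1, z, w) = value_sum a (x, y - 1, z + 1, w)"
      by (rule determinedD[OF that(1)]) (use s in \<open>auto simp: admissible_def\<close>)
    then show ?thesis by (simp add: algebra_simps)
  qed
  have right: "a 2 - a 1 = a 3 - a 2" if determined and big: "r 2 \<ge> 2"
  proof -
    obtain x y z w where s: "0 \<le> x" "x \<le> r 0" "1 \<le> y" "y \<le> r 1" "1 \<le> z" "z \<le> r 2 - 1"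
      "0 \<le> w" "w \<le> r 3 - 1" "x + y + z + w = h"
      by (rule ex_sum4_between[of 0 "r 0" 1 "r 1" 1 "r 2 - 1" 0 "r 3 - 1" h]) (use r h big in auto)
    have "value_sum a (x, y - 1, z + 1, w) = value_sum a (x, y, z - 1, w + 1)"
      by (rule determinedD[OF that(1)]) (use s in \<open>auto simp: admissible_def\<close>)
    then show ?thesis by (simp add: algebra_simps)
  qed
  have prog: determined if "a 1 - a 0 = a 2 - a 1" "a 2 - a 1 = a 3 - a 2"
  proof -
    define d where "d = a 1 - a 0"
    have eqs: "a 1 = a 0 + d" "a 2 = a 0 + 2 * d" "a 3 = a 0 + 3 * d" using that by (auto simp: d_def)
    have "value_sum a s = h * a 0 + index_sum s * d" if "s \<in> ?P" for s
      using that by (auto simp: admissible_def eqs algebra_simps simp del: One_nat_def)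
    then show ?thesis unfolding determined_def by simp
  qed
  have sym: determined if eq: "a 1 - a 0 = a 3 - a 2" and one: "r 1 = 1" "r 2 = 1"
    unfolding determined_def
  proof (intro ballI impI)
    fix s t assume st: "s \<in> ?P" "t \<in> ?P" "index_sum s = index_sum t"
    obtain x y z w x' y' z' w' where s: "s = (x, y, z, w)" and t: "t = (x', y', z', w')"
      by (cases s, cases t) auto
    have "y = 0 \<or> y = 1" "z = 0 \<or> z = 1" "y' = 0 \<or> y' = 1" "z' = 0 \<or> z' = 1"
      using st(1,2) one by (auto simp: s t admissible_def)
    moreover have "y + 2 * z + 3 * w = y' + 2 * z' + 3 * w'" using st(3) by (simp add: s t)
    \<comment> \<open>The index sum is \<open>(y - z) + 3 * (z + w)\<close> with
      \<open>y - z\<close> in {-1, 0, 1}, so its residue modulo 3 determines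
      \<open>y - z\<close>.\<close>
    ultimately have eq': "y - z = y' - z'" "z + w = z' + w'"
      by presburger+
    \<comment> \<open>The tuples differ by a multiple of (-1, 1, 1, -1), which changes the value by
      a multiple of \<open>a 1 + a 2 - a 0 - a 3\<close>, that is, by 0.\<close>
    then have y: "y = y' + (w' - w)" "z = z' + (w' - w)" by auto
    have "x = h - y - z - w" "x' = h - y' - z' - w'" using st(1,2) by (auto simp: s t admissible_def)
    then have x: "x = x' - (w' - w)" using y by simp
    have a3: "a 3 = a 1 - a 0 + a 2" using eq by simp
    show "value_sum a s = value_sum a t" by (simp add: s t x y a3 algebra_simps)
  qed
  obtain x y z w where "0 \<le> x" "x \<le> r 0" "0 \<le> y" "y \<le> r 1" "0 \<le> z" "z \<le> r 2" "0 \<le> w" "w \<le> r 3"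
    "x + y + z + w = h"
    by (rule ex_sum4_between[of 0 "r 0" 0 "r 1" 0 "r 2" 0 "r 3" h]) (use r h in auto)
  then have "(x, y, z, w) \<in> ?P" by (simp add: admissible_def)
  then have nonempty: "?P \<noteq> {}" by blast
  have "int (card (restricted_sumset 4 r h a)) = L_bound 4 r h \<longleftrightarrow> determined"
    using card_values_eq_iff[OF a r(2,3) nonempty] L_bound_4[OF r] h
    by (simp add: restricted_sumset_4 determined_def)
  moreover have "is_arith_prog 4 A \<longleftrightarrow> a 1 - a 0 = a 2 - a 1 \<and> a 2 - a 1 = a 3 - a 2"
    using is_arith_prog_4_iff[of a] a assms(1) by simp
  \<comment> \<open>Together with \<open>outer\<close>, either of \<open>left\<close> and
    \<open>right\<close> makes all three gaps equal.\<close>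
  ultimately show ?thesis using outer left right prog sym by metis
qed

end
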